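(* Let $A\in\mathbb{R}^{n\times n}$ and $C\in\mathbb{R}^{m\times n}$, and consider the discrete-time linear system $$x_{k+1}=Ax_k,\qquad y_k=Cx_k,\qquad k\in\mathbb{N},$$ with state $x_k\in\mathbb{R}^n$ and output $y_k\in\mathbb{R}^m$. Let $N\geq 1$ be an integer such that the matrix $[C^{T}\ A^{T}C^{T}\ \ldots\ (A^{N-1})^{T}C^{T}]$ is full row rank. Let $R\in\mathbb{R}^{m\times m}$ be a symmetric positive definite matrix, and define, for $\xi,z\in\mathbb{R}^n$ and $y\in\mathbb{R}^m$, $$J(\xi,z,y):=\|CA^{N-1}\xi-y\|_{R}^{2}+\sum_{i=0}^{N-2}\|CA^{i}\xi-CA^{i}z\|_{R}^{2}.$$ Consider the observer $$z_{k+1}=A\,\eta(z_k,y_k),\qquad \hat x_k=A^{N-1}z_k,\qquad k\in\mathbb{N},$$ where $\eta(z,y)=\arg\min_{\xi\in\mathbb{R}^n}J(\xi,z,y)$. Then, for all initial conditions $x_0,z_0\in\mathbb{R}^n$, $\|\hat x_k-x_k\|\to 0$ as $k\to\infty$.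
   Context: $\mathbb{N}$ denotes the nonnegative integers, $\|\cdot\|$ is the Euclidean norm, and $\|v\|_{R}^{2}=v^{T}Rv$. An empty sum (the case $N=1$) is zero. *)

theory Defs
  imports "HOL-Analysis.Analysis"
begin

text \<open>The library's power operation on \<open>real^'n^'n\<close> is componentwise, so the power with
  respect to the matrix product is defined here.\<close>

primrec mat_power :: "real^'n^'n \<Rightarrow> nat \<Rightarrow> real^'n^'n" where
  "mat_power A 0 = mat 1"
| "mat_power A (Suc k) = A ** mat_power A k"

definition sym_pos_def :: "real^'m^'m \<Rightarrow> bool" where
  "sym_pos_def R \<longleftrightarrow> transpose R = R \<and> (\<forall>v. v \<noteq> 0 \<longrightarrow> 0 < v \<bullet> (R *v v))"

definition wnorm_sq :: "real^'m^'m \<Rightarrow> real^'m \<Rightarrow> real" where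
  "wnorm_sq R v = v \<bullet> (R *v v)"

text \<open>The rank of the block matrix \<open>[M 0  M 1  \<dots>  M (N - 1)]\<close>. Since \<open>N\<close> is a natural number
  and not a type, the block matrix is represented by its set of columns; the rank is the dimension
  of their span. The lemma after the definition shows that this is the library's rank of the
  block matrix for any finite type \<open>'h\<close> whose elements number the \<open>N\<close> blocks.\<close>

definition block_row_rank :: "nat \<Rightarrow> (nat \<Rightarrow> real^'c^'r) \<Rightarrow> nat" where
  "block_row_rank N M = dim (\<Union>i<N. columns (M i))"

lemma block_row_rank_eq_rank:
  fixes M :: "nat \<Rightarrow> real^'c^'r" and e :: "'h::finite \<Rightarrow> nat"
  assumes "bij_betw e UNIV {..<N}"
  shows "block_row_rank N M =
    rank (\<chi> r p. M (e (fst p)) $ r $ snd p :: real^('h \<times> 'c)^'r)"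
proof -
  let ?B = "\<chi> r p. M (e (fst p)) $ r $ snd p :: real^('h \<times> 'c)^'r"
  have col: "column (h, c) ?B = column c (M (e h))" for h c
    by (simp add: column_def)
  have "columns ?B = (\<Union>h. columns (M (e h)))"
    by (auto simp: columns_def col)
  also have "\<dots> = (\<Union>i\<in>e ` UNIV. columns (M i))"
    by simp
  also have "e ` UNIV = {..<N}"
    using assms by (simp add: bij_betw_def)
  finally show ?thesis
    by (simp add: block_row_rank_def column_rank_def)
qed

definition obs_full_row_rank :: "real^'n^'n \<Rightarrow> real^'n^'m \<Rightarrow> nat \<Rightarrow> bool" where
  "obs_full_row_rank A C N \<longleftrightarrow>
    block_row_rank N (\<lambda>i. transpose (mat_power A i) ** transpose C) = CARD('n)"

definition cost ::
  "real^'n^'n \<Rightarrow> real^'n^'m \<Rightarrow> nat \<Rightarrow> real^'m^'m \<Rightarrow> real^'n \<Rightarrow> real^'n \<Rightarrow> real^'m \<Rightarrow> real" where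
  "cost A C N R \<xi> z y =
    wnorm_sq R ((C ** mat_power A (N - 1)) *v \<xi> - y)
    + (\<Sum>i<N - 1. wnorm_sq R ((C ** mat_power A i) *v \<xi> - (C ** mat_power A i) *v z))"

definition eta ::
  "real^'n^'n \<Rightarrow> real^'n^'m \<Rightarrow> nat \<Rightarrow> real^'m^'m \<Rightarrow> real^'n \<Rightarrow> real^'m \<Rightarrow> real^'n" where
  "eta A C N R z y = arg_min (\<lambda>\<xi>. cost A C N R \<xi> z y) (\<lambda>_. True)"

end

theory Submission
  imports Defs
begin

text \<open>
  For \<open>k \<ge> N - 1\<close> the state is \<open>x\<^sub>k = A\<^sup>N\<^sup>-\<^sup>1 w\<close> with \<open>w\<close> the state \<open>N - 1\<close> steps earlier, so \<open>z\<^sub>k\<close> is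
  an estimate of this delayed state and it suffices that \<open>e = z\<^sub>k - w\<close> tends to zero. Put
  \<open>f = \<eta>(z\<^sub>k, y\<^sub>k) - w\<close>. Since both the delayed state and the estimate are propagated by \<open>A\<close>, the
  next error is \<open>A f\<close>.

  The cost is a quadratic function of \<open>\<xi>\<close> whose Hessian form
  \<open>Q v = \<Sum>i<N. \<parallel>C A\<^sup>i v\<parallel>\<^sub>R\<^sup>2\<close> is positive definite by observability. It therefore has a unique
  minimiser, and its value at any point exceeds the minimum by \<open>Q\<close> of the displacement
  (\<open>cost_eq_cost_eta_plus\<close>). At \<open>\<xi> = w\<close> the output term vanishes, because \<open>y\<^sub>k = C A\<^sup>N\<^sup>-\<^sup>1 w\<close>. With
  \<open>P v = \<Sum>i<N-1. \<parallel>C A\<^sup>i v\<parallel>\<^sub>R\<^sup>2\<close> this gives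
  \<open>P e = \<parallel>C A\<^sup>N\<^sup>-\<^sup>1 f\<parallel>\<^sub>R\<^sup>2 + P (f - e) + Q f\<close>, and since \<open>Q f = \<parallel>C f\<parallel>\<^sub>R\<^sup>2 + P (A f)\<close>, the function \<open>P\<close>
  decreases along the error by
  \<open>\<parallel>C f\<parallel>\<^sub>R\<^sup>2 + \<parallel>C A\<^sup>N\<^sup>-\<^sup>1 f\<parallel>\<^sub>R\<^sup>2 + P (f - e)\<close> (\<open>error_energy_balance\<close>).

  A decreasing nonnegative sequence has vanishing decrements, so \<open>C f\<^sub>k \<longlonglongrightarrow> 0\<close> and
  \<open>C A\<^sup>i (f\<^sub>k - e\<^sub>k) \<longlonglongrightarrow> 0\<close> for \<open>i < N - 1\<close>. As \<open>e\<^sub>k\<^sub>+\<^sub>1 = A f\<^sub>k\<close>, the second fact says that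
  \<open>C A\<^sup>i\<^sup>+\<^sup>1 f\<^sub>k\<close> and \<open>C A\<^sup>i f\<^sub>k\<^sub>+\<^sub>1\<close> have the same limit behaviour, so induction on \<open>i\<close> yields
  \<open>C A\<^sup>i f\<^sub>k \<longlonglongrightarrow> 0\<close> for all \<open>i < N\<close>, hence \<open>f\<^sub>k \<longlonglongrightarrow> 0\<close> by observability, and with it
  \<open>e\<^sub>k\<^sub>+\<^sub>1 = A f\<^sub>k \<longlonglongrightarrow> 0\<close> (\<open>error_tendsto_zero\<close>).
\<close>

section \<open>Positive definite quadratic forms\<close>

text \<open>By compactness the form has a positive minimum on the unit sphere, so it dominates a positive
  multiple of the squared norm.\<close>

lemma pos_form_tendsto_zero_imp:
  fixes F :: "'a::euclidean_space \<Rightarrow> 'a" and v :: "nat \<Rightarrow> 'a"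
  assumes lin: "linear F" and pos: "\<And>u. u \<noteq> 0 \<Longrightarrow> 0 < u \<bullet> F u"
    and lim: "(\<lambda>k. v k \<bullet> F (v k)) \<longlonglongrightarrow> 0"
  shows "v \<longlonglongrightarrow> 0"
proof -
  have "continuous_on (sphere 0 1) (\<lambda>u. u \<bullet> F u)"
    by (intro continuous_intros linear_continuous_on linear_conv_bounded_linear[THEN iffD1, OF lin])
  moreover have "sphere (0::'a) 1 \<noteq> {}" by simp
  ultimately obtain s where s: "s \<in> sphere 0 1"
    and min: "\<And>u. u \<in> sphere 0 1 \<Longrightarrow> s \<bullet> F s \<le> u \<bullet> F u"
    using continuous_attains_inf[OF compact_sphere] by blast
  define c where "c = s \<bullet> F s"
  have c: "c > 0" unfolding c_def using s by (intro pos) auto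
  have bound: "c * (norm u)\<^sup>2 \<le> u \<bullet> F u" for u
  proof (cases "u = 0")
    case False
    have "c \<le> (u /\<^sub>R norm u) \<bullet> F (u /\<^sub>R norm u)"
      unfolding c_def using False by (intro min) simp
    also have "\<dots> = (u \<bullet> F u) / (norm u)\<^sup>2"
      by (simp add: linear_cmul[OF lin] power2_eq_square divide_simps)
    finally show ?thesis using False by (simp add: field_simps)
  qed simp
  have "(\<lambda>k. (norm (v k))\<^sup>2) \<longlonglongrightarrow> 0"
  proof (rule tendsto_sandwich[OF _ _ tendsto_const])
    show "\<forall>\<^sub>F k in sequentially. (norm (v k))\<^sup>2 \<le> (v k \<bullet> F (v k)) / c"
      using bound c by (simp add: field_simps)
    show "(\<lambda>k. (v k \<bullet> F (v k)) / c) \<longlonglongrightarrow> 0"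
      using tendsto_divide[OF lim tendsto_const, of c] c by simp
  qed simp
  then have "(\<lambda>k. sqrt ((norm (v k))\<^sup>2)) \<longlonglongrightarrow> sqrt 0"
    by (rule tendsto_real_sqrt)
  then show ?thesis by (simp add: tendsto_norm_zero_iff)
qed

lemma wnorm_sq_nonneg: "sym_pos_def R \<Longrightarrow> 0 \<le> wnorm_sq R v"
  by (cases "v = 0") (auto simp: sym_pos_def_def wnorm_sq_def intro: less_imp_le)

lemma wnorm_sq_eq_0_iff: "sym_pos_def R \<Longrightarrow> wnorm_sq R v = 0 \<longleftrightarrow> v = 0"
  by (cases "v = 0") (auto simp: sym_pos_def_def wnorm_sq_def dest: spec[of _ v])

lemma wnorm_sq_tendsto_zero_imp:
  fixes v :: "nat \<Rightarrow> real^'m"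
  assumes "sym_pos_def R" "(\<lambda>k. wnorm_sq R (v k)) \<longlonglongrightarrow> 0"
  shows "v \<longlonglongrightarrow> 0"
  using assms
  by (intro pos_form_tendsto_zero_imp[of "(*v) R"]) (auto simp: sym_pos_def_def wnorm_sq_def)

lemma wnorm_sq_minus: "wnorm_sq R (- v) = wnorm_sq R v"
  using matrix_vector_mult_diff_distrib[of R 0 v] by (simp add: wnorm_sq_def)

lemma wnorm_sq_add:
  assumes "transpose R = R"
  shows "wnorm_sq R (u + v) = wnorm_sq R u + wnorm_sq R v + 2 * (u \<bullet> (R *v v))"
proof -
  have "v \<bullet> (R *v u) = u \<bullet> (R *v v)"
    using assms by (metis dot_lmul_matrix inner_commute transpose_matrix_vector)
  then show ?thesis
    by (simp add: wnorm_sq_def matrix_vector_right_distrib inner_add_left inner_add_right)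
qed

section \<open>Weighted least squares\<close>

text \<open>The matrix of the normal equations of the least squares problem
  \<open>min\<^sub>\<xi> \<Sum>i<N. \<parallel>G i \<xi> - b i\<parallel>\<^sub>R\<^sup>2\<close>, as a linear map.\<close>

definition gram :: "real^'m^'m \<Rightarrow> (nat \<Rightarrow> real^'n^'m) \<Rightarrow> nat \<Rightarrow> real^'n \<Rightarrow> real^'n" where
  "gram R G N v = (\<Sum>i<N. transpose (G i) *v (R *v (G i *v v)))"

lemma inner_transpose_mult: "u \<bullet> (transpose M *v w) = (M *v u) \<bullet> (w :: real^'m)"
  by (metis dot_lmul_matrix inner_commute transpose_matrix_vector)

lemma linear_gram: "linear (gram R G N)"
  unfolding gram_def
  by (intro linear_compose_sum ballI)
    (simp add: matrix_vector_mul_assoc)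

lemma inner_gram: "v \<bullet> gram R G N v = (\<Sum>i<N. wnorm_sq R (G i *v v))"
  by (simp add: gram_def inner_sum_right inner_transpose_mult wnorm_sq_def
      del: transpose_matrix_vector)

lemma inner_gram_pos:
  assumes "sym_pos_def R" and "\<And>v. (\<And>i. i < N \<Longrightarrow> G i *v v = 0) \<Longrightarrow> v = 0" and "v \<noteq> 0"
  shows "0 < v \<bullet> gram R G N v"
proof -
  have "(\<Sum>i<N. wnorm_sq R (G i *v v)) \<noteq> 0"
    using assms by (auto simp: sum_nonneg_eq_0_iff wnorm_sq_nonneg wnorm_sq_eq_0_iff)
  moreover have "0 \<le> (\<Sum>i<N. wnorm_sq R (G i *v v))"
    by (intro sum_nonneg wnorm_sq_nonneg assms)
  ultimately show ?thesis by (simp add: inner_gram)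
qed

text \<open>A positive definite linear map is injective, hence surjective in finite dimension, so the
  normal equations have a solution. There the linear term of the expansion vanishes.\<close>

lemma least_squares_complete_square:
  fixes G :: "nat \<Rightarrow> real^'n^'m" and b :: "nat \<Rightarrow> real^'m"
  assumes R: "sym_pos_def R" and G: "\<And>v. (\<And>i. i < N \<Longrightarrow> G i *v v = 0) \<Longrightarrow> v = 0"
  obtains \<xi>\<^sub>0 where "\<And>\<xi>. (\<Sum>i<N. wnorm_sq R (G i *v \<xi> - b i)) =
    (\<Sum>i<N. wnorm_sq R (G i *v \<xi>\<^sub>0 - b i)) + (\<Sum>i<N. wnorm_sq R (G i *v (\<xi> - \<xi>\<^sub>0)))"
proof -
  have "inj (gram R G N)"
    using inner_gram_pos[OF R G]
    by (intro linear_injective_0[OF linear_gram, THEN iffD2]) fastforce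
  then have "surj (gram R G N)"
    by (rule linear_injective_imp_surjective[OF linear_gram]) simp
  then obtain \<xi>\<^sub>0 where \<xi>\<^sub>0: "gram R G N \<xi>\<^sub>0 = (\<Sum>i<N. transpose (G i) *v (R *v b i))"
    by (metis surjD)
  have "(\<Sum>i<N. wnorm_sq R (G i *v \<xi> - b i)) =
    (\<Sum>i<N. wnorm_sq R (G i *v \<xi>\<^sub>0 - b i)) + (\<Sum>i<N. wnorm_sq R (G i *v (\<xi> - \<xi>\<^sub>0)))" for \<xi>
  proof -
    let ?d = "\<xi> - \<xi>\<^sub>0"
    have "wnorm_sq R (G i *v \<xi> - b i) = wnorm_sq R (G i *v ?d) + wnorm_sq R (G i *v \<xi>\<^sub>0 - b i)
      + 2 * ((G i *v ?d) \<bullet> (R *v (G i *v \<xi>\<^sub>0 - b i)))" for i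
      using R wnorm_sq_add[of R "G i *v ?d" "G i *v \<xi>\<^sub>0 - b i"]
      by (simp add: sym_pos_def_def matrix_vector_mult_diff_distrib)
    moreover have "(\<Sum>i<N. (G i *v ?d) \<bullet> (R *v (G i *v \<xi>\<^sub>0 - b i))) =
      ?d \<bullet> (gram R G N \<xi>\<^sub>0 - (\<Sum>i<N. transpose (G i) *v (R *v b i)))"
      by (simp add: gram_def inner_diff_right inner_sum_right inner_transpose_mult
          matrix_vector_mult_diff_distrib sum_subtractf del: transpose_matrix_vector)
    ultimately show ?thesis
      using \<xi>\<^sub>0 by (simp add: sum.distrib flip: sum_distrib_left)
  qed
  then show thesis by (rule that)
qed

section \<open>Observability and the minimiser of the cost\<close>

lemma mat_power_Suc_right: "mat_power A (Suc i) = mat_power A i ** A"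
  by (induction i) (simp_all add: matrix_mul_assoc)

lemma obs_mult_step: "(C ** mat_power A i) *v (A *v v) = (C ** mat_power A (Suc i)) *v v"
  by (simp only: mat_power_Suc_right matrix_vector_mul_assoc matrix_mul_assoc)

text \<open>A vector annihilated by all \<open>C A\<^sup>i\<close> is orthogonal to the columns of the transposed
  observability matrix, which span the whole space.\<close>

lemma obs_full_row_rankD:
  assumes rank: "obs_full_row_rank A C N"
    and v: "\<And>i. i < N \<Longrightarrow> (C ** mat_power A i) *v v = 0"
  shows "v = 0"
proof -
  let ?S = "\<Union>i<N. columns (transpose (mat_power A i) ** transpose C)"
  have "span ?S = UNIV"
    using rank unfolding obs_full_row_rank_def block_row_rank_def
    by (simp add: dim_eq_full[symmetric])
  moreover have "orthogonal v s" if s: "s \<in> ?S" for s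
  proof -
    obtain i j where i: "i < N" and "s = column j (transpose (C ** mat_power A i))"
      using s by (auto simp: columns_def matrix_transpose_mul)
    then have "s \<bullet> v = ((C ** mat_power A i) *v v) $ j"
      by (simp add: matrix_vector_mul_component row_def)
    then show ?thesis using v[OF i] by (simp add: orthogonal_def inner_commute)
  qed
  ultimately have "orthogonal v v"
    using orthogonal_to_span by blast
  then show ?thesis by (simp add: orthogonal_def)
qed

text \<open>The minimiser of \<open>J\<close> exists and is unique because the excess is positive definite in the
  displacement, so the choice made by \<open>eta\<close> is the solution of the normal equations.\<close>

lemma cost_eq_cost_eta_plus:
  assumes R: "sym_pos_def R" and rank: "obs_full_row_rank A C (Suc n)"
  shows "cost A C (Suc n) R \<xi> z y = cost A C (Suc n) R (eta A C (Suc n) R z y) z y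
    + (\<Sum>i<Suc n. wnorm_sq R ((C ** mat_power A i) *v (\<xi> - eta A C (Suc n) R z y)))"
proof -
  let ?G = "\<lambda>i. C ** mat_power A i"
  let ?b = "\<lambda>i. if i < n then ?G i *v z else y"
  let ?J = "\<lambda>\<xi>. cost A C (Suc n) R \<xi> z y"
  let ?Q = "\<lambda>v. \<Sum>i<Suc n. wnorm_sq R (?G i *v v)"
  have cost: "?J \<xi> = (\<Sum>i<Suc n. wnorm_sq R (?G i *v \<xi> - ?b i))" for \<xi>
    by (simp add: cost_def)
  obtain \<xi>\<^sub>0 where \<xi>\<^sub>0: "\<And>\<xi>. ?J \<xi> = ?J \<xi>\<^sub>0 + ?Q (\<xi> - \<xi>\<^sub>0)"
    unfolding cost
    using least_squares_complete_square[OF R, of "Suc n" ?G ?b] obs_full_row_rankD[OF rank]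
    by blast
  have Q_nonneg: "0 \<le> ?Q v" for v
    by (intro sum_nonneg wnorm_sq_nonneg R)
  have "?J \<xi>\<^sub>0 \<le> ?J \<xi>" for \<xi>
    using \<xi>\<^sub>0[of \<xi>] Q_nonneg[of "\<xi> - \<xi>\<^sub>0"] by linarith
  moreover have "\<xi> = \<xi>\<^sub>0" if "\<And>\<xi>'. ?J \<xi> \<le> ?J \<xi>'" for \<xi>
  proof -
    have "?Q (\<xi> - \<xi>\<^sub>0) = 0"
      using \<xi>\<^sub>0[of \<xi>] that[of \<xi>\<^sub>0] Q_nonneg[of "\<xi> - \<xi>\<^sub>0"] by linarith
    then have "?G i *v (\<xi> - \<xi>\<^sub>0) = 0" if "i < Suc n" for i
      using that R
      by (subst (asm) sum_nonneg_eq_0_iff) (auto simp: wnorm_sq_nonneg wnorm_sq_eq_0_iff)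
    then show ?thesis using obs_full_row_rankD[OF rank] by fastforce
  qed
  ultimately have "eta A C (Suc n) R z y = \<xi>\<^sub>0"
    unfolding eta_def arg_min_def is_arg_min_linorder
    by (intro some_equality) auto
  then show ?thesis using \<xi>\<^sub>0[of \<xi>] by (simp only:)
qed

section \<open>Convergence of the estimation error\<close>

text \<open>Comparing the minimal cost with the cost of the exact state \<open>w\<close>, which explains the output
  perfectly. The term \<open>\<parallel>C f\<parallel>\<^sub>R\<^sup>2\<close> appears because the forms \<open>Q f\<close> and \<open>P (A f)\<close> differ by an index
  shift.\<close>

lemma error_energy_balance:
  fixes z w :: "real^'n"
  assumes R: "sym_pos_def R" and rank: "obs_full_row_rank A C (Suc n)"
    and f: "f = eta A C (Suc n) R z ((C ** mat_power A n) *v w) - w"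
  defines "P \<equiv> \<lambda>v. \<Sum>i<n. wnorm_sq R ((C ** mat_power A i) *v v)"
  shows "P (z - w) = P (A *v f) + wnorm_sq R (C *v f)
    + wnorm_sq R ((C ** mat_power A n) *v f) + P (f - (z - w))"
proof -
  let ?G = "\<lambda>i. C ** mat_power A i"
  let ?y = "?G n *v w"
  let ?\<eta> = "eta A C (Suc n) R z ?y"
  have \<eta>: "?\<eta> = w + f" using f by simp
  have "P (z - w) = cost A C (Suc n) R w z ?y"
    using wnorm_sq_minus[of R "?G _ *v w - ?G _ *v z"]
    by (simp add: cost_def P_def wnorm_sq_def[of R 0] matrix_vector_mult_diff_distrib)
  also have "\<dots> = cost A C (Suc n) R ?\<eta> z ?y + (\<Sum>i<Suc n. wnorm_sq R (?G i *v (w - ?\<eta>)))"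
    by (rule cost_eq_cost_eta_plus[OF R rank])
  also have "cost A C (Suc n) R ?\<eta> z ?y = wnorm_sq R (?G n *v f) + P (f - (z - w))"
    unfolding \<eta>
    by (simp add: cost_def P_def algebra_simps)
  also have "(\<Sum>i<Suc n. wnorm_sq R (?G i *v (w - ?\<eta>))) = (\<Sum>i<Suc n. wnorm_sq R (?G i *v f))"
  proof (rule sum.cong)
    fix i
    have "?G i *v (w - ?\<eta>) = - (?G i *v f)"
      unfolding \<eta> using linear_neg[OF matrix_vector_mul_linear, of "?G i" f] by simp
    then show "wnorm_sq R (?G i *v (w - ?\<eta>)) = wnorm_sq R (?G i *v f)"
      by (simp only: wnorm_sq_minus)
  qed simp
  also have "\<dots> = wnorm_sq R (C *v f) + P (A *v f)"
    unfolding P_def obs_mult_step by (subst sum.lessThan_Suc_shift) simp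
  finally show ?thesis by simp
qed

lemma tendsto_matrix_vector_mult:
  fixes M :: "real^'a^'b"
  shows "(g \<longlongrightarrow> l) F \<Longrightarrow> ((\<lambda>k. M *v g k) \<longlongrightarrow> M *v l) F"
  by (rule bounded_linear.tendsto[OF matrix_vector_mul_bounded_linear])

lemma decrement_part_tendsto_zero:
  fixes V d :: "nat \<Rightarrow> real"
  assumes "\<And>k. 0 \<le> V k" "\<And>k. 0 \<le> d k" "\<And>k. V (Suc k) + d k \<le> V k"
  shows "d \<longlonglongrightarrow> 0"
proof -
  have "decseq V"
    using assms(2,3) by (intro decseq_SucI) (metis add_increasing2 order.refl order.trans)
  then obtain L where L: "V \<longlonglongrightarrow> L"
    using decseq_convergent[of V 0] assms(1) by blast
  have lim: "(\<lambda>k. V k - V (Suc k)) \<longlonglongrightarrow> 0"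
    using tendsto_diff[OF L LIMSEQ_Suc[OF L]] by simp
  show ?thesis
  proof (rule real_tendsto_sandwich[OF _ _ tendsto_const lim])
    show "\<forall>\<^sub>F k in sequentially. 0 \<le> d k"
      using assms(2) by simp
    show "\<forall>\<^sub>F k in sequentially. d k \<le> V k - V (Suc k)"
      using assms(3) by (simp add: algebra_simps)
  qed
qed

text \<open>Here \<open>e\<close> is the estimation error and \<open>f\<close> the error after the measurement update. The four
  terms of the balance are nonnegative, so the last three are bounded by the decrement of \<open>P\<close> and
  vanish in the limit. The dynamics carry the smallness of \<open>C f\<close> up to each \<open>C A\<^sup>i f\<close>, and
  observability carries it to \<open>f\<close> itself.\<close>

lemma error_tendsto_zero:
  fixes e f :: "nat \<Rightarrow> real^'n"
  assumes R: "sym_pos_def R" and rank: "obs_full_row_rank A C (Suc n)"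
    and step: "\<And>k. e (Suc k) = A *v f k"
  defines "P \<equiv> \<lambda>v. \<Sum>i<n. wnorm_sq R ((C ** mat_power A i) *v v)"
  assumes balance: "\<And>k. P (e k) = P (A *v f k) + wnorm_sq R (C *v f k)
    + wnorm_sq R ((C ** mat_power A n) *v f k) + P (f k - e k)"
  shows "e \<longlonglongrightarrow> 0"
proof -
  let ?G = "\<lambda>i. C ** mat_power A i"
  have wnn: "0 \<le> wnorm_sq R v" for v
    by (rule wnorm_sq_nonneg[OF R])
  have P_nonneg: "0 \<le> P v" for v
    unfolding P_def by (intro sum_nonneg wnn)
  have Cf: "(\<lambda>k. C *v f k) \<longlonglongrightarrow> 0"
  proof (rule wnorm_sq_tendsto_zero_imp[OF R], rule decrement_part_tendsto_zero[of "\<lambda>k. P (e k)"])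
    show "P (e (Suc k)) + wnorm_sq R (C *v f k) \<le> P (e k)" for k
      unfolding step balance[of k] using P_nonneg[of "f k - e k"] wnn[of "?G n *v f k"] by linarith
  qed (rule P_nonneg wnn)+
  have Gfe: "(\<lambda>k. ?G i *v (f k - e k)) \<longlonglongrightarrow> 0" if "i < n" for i
  proof (rule wnorm_sq_tendsto_zero_imp[OF R], rule decrement_part_tendsto_zero[of "\<lambda>k. P (e k)"])
    fix k
    have "wnorm_sq R (?G i *v (f k - e k)) \<le> P (f k - e k)"
      unfolding P_def using that wnn
      by (intro member_le_sum[of i "{..<n}" "\<lambda>i. wnorm_sq R (?G i *v (f k - e k))"]) auto
    then show "P (e (Suc k)) + wnorm_sq R (?G i *v (f k - e k)) \<le> P (e k)"
      unfolding step balance[of k] using wnn[of "C *v f k"] wnn[of "?G n *v f k"] by linarith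
  qed (rule P_nonneg wnn)+
  have Gf: "(\<lambda>k. ?G i *v f k) \<longlonglongrightarrow> 0" if "i \<le> n" for i
    using that
  proof (induction i)
    case 0
    then show ?case using Cf by simp
  next
    case (Suc i)
    then have "(\<lambda>k. ?G i *v f k - ?G i *v (f k - e k)) \<longlonglongrightarrow> 0 - 0"
      by (intro tendsto_diff Gfe) auto
    \<comment> \<open>Passing to the next time step trades \<open>e\<close> for \<open>A f\<close>, which raises the power of \<open>A\<close>.\<close>
    then have "(\<lambda>k. ?G i *v e k) \<longlonglongrightarrow> 0"
      by (simp add: matrix_vector_mult_diff_distrib)
    then have "(\<lambda>k. ?G i *v e (Suc k)) \<longlonglongrightarrow> 0"
      by (rule LIMSEQ_Suc)
    then show ?case
      unfolding step obs_mult_step .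
  qed
  have "f \<longlonglongrightarrow> 0"
  proof (rule pos_form_tendsto_zero_imp[OF linear_gram])
    show "0 < v \<bullet> gram R ?G (Suc n) v" if "v \<noteq> 0" for v
      by (rule inner_gram_pos[OF R obs_full_row_rankD[OF rank] that])
    have "(\<lambda>k. wnorm_sq R (?G i *v f k)) \<longlonglongrightarrow> 0" if "i < Suc n" for i
      using that tendsto_inner[OF Gf tendsto_matrix_vector_mult[OF Gf], of i i R]
      by (simp add: wnorm_sq_def)
    then show "(\<lambda>k. f k \<bullet> gram R ?G (Suc n) (f k)) \<longlonglongrightarrow> 0"
      unfolding inner_gram by (intro tendsto_null_sum) auto
  qed
  then have "(\<lambda>k. A *v f k) \<longlonglongrightarrow> A *v 0"
    by (rule tendsto_matrix_vector_mult)
  then show ?thesis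
    by (simp add: filterlim_sequentially_Suc[of e, symmetric] step)
qed

theorem theorem2:
  fixes A :: "real^'n^'n" and C :: "real^'n^'m" and R :: "real^'m^'m" and N :: nat
    and x z xhat :: "nat \<Rightarrow> real^'n" and y :: "nat \<Rightarrow> real^'m"
  assumes "N \<ge> 1"
    and "obs_full_row_rank A C N"
    and "sym_pos_def R"
    and "\<And>k. x (Suc k) = A *v x k"
    and "\<And>k. y k = C *v x k"
    and "\<And>k. z (Suc k) = A *v eta A C N R (z k) (y k)"
    and "\<And>k. xhat k = mat_power A (N - 1) *v z k"
  shows "(\<lambda>k. norm (xhat k - x k)) \<longlonglongrightarrow> 0"
proof -
  obtain n where N: "N = Suc n"
    using assms(1) by (cases N) auto
  have x_shift: "x (k + i) = mat_power A i *v x k" for k i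
    by (induction i) (simp_all add: assms(4) matrix_vector_mul_assoc)
  have y_shift: "y (k + n) = (C ** mat_power A n) *v x k" for k
    by (simp add: assms(5) x_shift matrix_vector_mul_assoc)
  \<comment> \<open>The observer state approximates the plant state \<open>n\<close> steps earlier, so the errors compare times
    \<open>k + n\<close> and \<open>k\<close>.\<close>
  define e where "e k = z (k + n) - x k" for k
  define f where "f k = eta A C (Suc n) R (z (k + n)) (y (k + n)) - x k" for k
  have "e (Suc k) = A *v f k" for k
    by (simp add: e_def f_def assms(4,6) N matrix_vector_mult_diff_distrib)
  moreover have "(\<Sum>i<n. wnorm_sq R ((C ** mat_power A i) *v e k)) =
      (\<Sum>i<n. wnorm_sq R ((C ** mat_power A i) *v (A *v f k))) + wnorm_sq R (C *v f k)
      + wnorm_sq R ((C ** mat_power A n) *v f k)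
      + (\<Sum>i<n. wnorm_sq R ((C ** mat_power A i) *v (f k - e k)))" for k
    unfolding e_def
    by (rule error_energy_balance[OF assms(3) assms(2)[unfolded N]]) (simp add: f_def y_shift)
  ultimately have "e \<longlonglongrightarrow> 0"
    by (rule error_tendsto_zero[OF assms(3) assms(2)[unfolded N]])
  then have "(\<lambda>k. mat_power A n *v e k) \<longlonglongrightarrow> mat_power A n *v 0"
    by (rule tendsto_matrix_vector_mult)
  moreover have "mat_power A n *v e k = xhat (k + n) - x (k + n)" for k
    by (simp add: e_def assms(7) N x_shift matrix_vector_mult_diff_distrib)
  ultimately have "(\<lambda>k. xhat (k + n) - x (k + n)) \<longlonglongrightarrow> 0"
    by simp
  then show ?thesis
    by (intro tendsto_norm_zero) (rule LIMSEQ_offset)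
qed

end
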